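(* Let $A_1$ and $A_2$ be Abelian groups. If $A_1$ and $A_2$ are equivalent in the second order logic $\mathcal L_2$ (i.e. exactly the same sentences of $\mathcal L_2$ are true in $A_1$ and in $A_2$), then the endomorphism rings $\mathrm{End}(A_1)$ and $\mathrm{End}(A_2)$ are elementarily equivalent, i.e. satisfy the same first order sentences of the ring language.
   Context: $\mathcal L_2$ is the second order language of Abelian groups, with equality and a ternary relation symbol for $x_1=x_2+x_3$, in which one may quantify over group elements and over $n$-ary relation (predicate) variables for every $n\ge1$; in a group $A$ object variables range over $A$ and $n$-ary predicate variables range over all subsets of $A^n$. The ring $\mathrm{End}(A)$ is the ring of endomorphisms of $A$ under pointwise addition and composition, regarded as a structure for the first order ring language (equality, addition, multiplication). *)

theory Defs
  imports "HOL-Algebra.Ring"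
begin

section \<open>The endomorphism ring of an Abelian group\<close>

text \<open>
  Abelian groups are written multiplicatively, as in \<^locale>\<open>comm_group\<close>. Endomorphisms are
  taken extensional (undefined off the carrier), so that equality of elements of
  the ring is equality of maps on the group. The product of \<open>f\<close> and \<open>g\<close> is
  \<open>f \<circ> g\<close>, that is, \<open>g\<close> is applied first.
\<close>

definition End_ring :: "('a, 'm) monoid_scheme \<Rightarrow> ('a \<Rightarrow> 'a) ring" where
  "End_ring A =
    \<lparr>carrier = hom A A \<inter> extensional (carrier A),
     monoid.mult = compose (carrier A),
     monoid.one = (\<lambda>x\<in>carrier A. x),
     ring.zero = (\<lambda>x\<in>carrier A. \<one>\<^bsub>A\<^esub>),
     ring.add = (\<lambda>f g. \<lambda>x\<in>carrier A. f x \<otimes>\<^bsub>A\<^esub> g x)\<rparr>"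

lemma ring_End_ring:
  assumes "comm_group A"
  shows "ring (End_ring A)"
proof -
  interpret comm_group A by fact
  have inv_ex: "\<exists>g \<in> carrier (End_ring A). g \<oplus>\<^bsub>End_ring A\<^esub> f = \<zero>\<^bsub>End_ring A\<^esub>"
    if f: "f \<in> carrier (End_ring A)" for f
    using f
    by (intro bexI[where x = "\<lambda>x\<in>carrier A. inv\<^bsub>A\<^esub> (f x)"])
      (auto simp: End_ring_def hom_def Pi_iff restrict_def extensional_def fun_eq_iff
        inv_mult l_inv)
  show ?thesis
  proof (rule ringI)
    show "abelian_group (End_ring A)"
      by (rule abelian_groupI)
        (use inv_ex in \<open>auto simp: End_ring_def hom_def Pi_iff restrict_def extensional_def
          fun_eq_iff m_ac\<close>)
    show "Group.monoid (End_ring A)"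
      by (rule monoidI)
        (auto simp: End_ring_def hom_def Pi_iff compose_def restrict_def extensional_def
          fun_eq_iff)
  qed (auto simp: End_ring_def hom_def Pi_iff compose_def restrict_def extensional_def
        fun_eq_iff)
qed

section \<open>The second order language of Abelian groups\<close>

text \<open>
  A predicate variable is given by its arity and an index. In the atomic formula
  \<open>SPred k xs\<close> the variable has arity \<open>length xs\<close> and index \<open>k\<close>; \<open>SAllP n k\<close> binds the
  variable of arity \<open>n\<close> and index \<open>k\<close>. The atom \<open>SAdd x y z\<close> stands for \<open>x = y + z\<close>.
  The remaining connectives and the existential quantifiers are the usual
  abbreviations.
\<close>

datatype so_fm =
    SEq nat nat
  | SAdd nat nat nat
  | SPred nat "nat list"
  | SNeg so_fm
  | SConj so_fm so_fm
  | SAll nat so_fm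
  | SAllP nat nat so_fm

text \<open>Predicate variables have arity at least 1; the datatype alone does not enforce this.\<close>

fun so_wf :: "so_fm \<Rightarrow> bool" where
  "so_wf (SEq x y) = True"
| "so_wf (SAdd x y z) = True"
| "so_wf (SPred k xs) = (length xs \<ge> 1)"
| "so_wf (SNeg \<phi>) = so_wf \<phi>"
| "so_wf (SConj \<phi> \<psi>) = (so_wf \<phi> \<and> so_wf \<psi>)"
| "so_wf (SAll x \<phi>) = so_wf \<phi>"
| "so_wf (SAllP n k \<phi>) = (n \<ge> 1 \<and> so_wf \<phi>)"

fun so_fv :: "so_fm \<Rightarrow> nat set" where
  "so_fv (SEq x y) = {x, y}"
| "so_fv (SAdd x y z) = {x, y, z}"
| "so_fv (SPred k xs) = set xs"
| "so_fv (SNeg \<phi>) = so_fv \<phi>"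
| "so_fv (SConj \<phi> \<psi>) = so_fv \<phi> \<union> so_fv \<psi>"
| "so_fv (SAll x \<phi>) = so_fv \<phi> - {x}"
| "so_fv (SAllP n k \<phi>) = so_fv \<phi>"

fun so_fpv :: "so_fm \<Rightarrow> (nat \<times> nat) set" where
  "so_fpv (SEq x y) = {}"
| "so_fpv (SAdd x y z) = {}"
| "so_fpv (SPred k xs) = {(length xs, k)}"
| "so_fpv (SNeg \<phi>) = so_fpv \<phi>"
| "so_fpv (SConj \<phi> \<psi>) = so_fpv \<phi> \<union> so_fpv \<psi>"
| "so_fpv (SAll x \<phi>) = so_fpv \<phi>"
| "so_fpv (SAllP n k \<phi>) = so_fpv \<phi> - {(n, k)}"

definition so_sentence :: "so_fm \<Rightarrow> bool" where
  "so_sentence \<phi> \<longleftrightarrow> so_wf \<phi> \<and> so_fv \<phi> = {} \<and> so_fpv \<phi> = {}"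

definition tuples :: "'a set \<Rightarrow> nat \<Rightarrow> 'a list set" where
  "tuples C n = {xs. length xs = n \<and> set xs \<subseteq> C}"

fun so_sat ::
  "('a, 'm) monoid_scheme \<Rightarrow> (nat \<Rightarrow> 'a) \<Rightarrow> (nat \<times> nat \<Rightarrow> 'a list set) \<Rightarrow> so_fm \<Rightarrow> bool" where
  "so_sat A s P (SEq x y) \<longleftrightarrow> s x = s y"
| "so_sat A s P (SAdd x y z) \<longleftrightarrow> s x = s y \<otimes>\<^bsub>A\<^esub> s z"
| "so_sat A s P (SPred k xs) \<longleftrightarrow> map s xs \<in> P (length xs, k)"
| "so_sat A s P (SNeg \<phi>) \<longleftrightarrow> \<not> so_sat A s P \<phi>"
| "so_sat A s P (SConj \<phi> \<psi>) \<longleftrightarrow> so_sat A s P \<phi> \<and> so_sat A s P \<psi>"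
| "so_sat A s P (SAll x \<phi>) \<longleftrightarrow> (\<forall>a\<in>carrier A. so_sat A (s(x := a)) P \<phi>)"
| "so_sat A s P (SAllP n k \<phi>) \<longleftrightarrow>
     (\<forall>R. R \<subseteq> tuples (carrier A) n \<longrightarrow> so_sat A s (P((n, k) := R)) \<phi>)"

definition so_true :: "('a, 'm) monoid_scheme \<Rightarrow> so_fm \<Rightarrow> bool" where
  "so_true A \<phi> \<longleftrightarrow>
    (\<forall>s P. range s \<subseteq> carrier A \<longrightarrow> (\<forall>n k. P (n, k) \<subseteq> tuples (carrier A) n) \<longrightarrow> so_sat A s P \<phi>)"

definition so_equivalent :: "('a, 'm) monoid_scheme \<Rightarrow> ('b, 'n) monoid_scheme \<Rightarrow> bool" where
  "so_equivalent A B \<longleftrightarrow> (\<forall>\<phi>. so_sentence \<phi> \<longrightarrow> (so_true A \<phi> \<longleftrightarrow> so_true B \<phi>))"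

section \<open>The first order language of rings\<close>

datatype rterm = RVar nat | RAdd rterm rterm | RMult rterm rterm

datatype fo_fm =
    FEq rterm rterm
  | FNeg fo_fm
  | FConj fo_fm fo_fm
  | FAll nat fo_fm

fun rterm_vars :: "rterm \<Rightarrow> nat set" where
  "rterm_vars (RVar x) = {x}"
| "rterm_vars (RAdd t u) = rterm_vars t \<union> rterm_vars u"
| "rterm_vars (RMult t u) = rterm_vars t \<union> rterm_vars u"

fun fo_fv :: "fo_fm \<Rightarrow> nat set" where
  "fo_fv (FEq t u) = rterm_vars t \<union> rterm_vars u"
| "fo_fv (FNeg \<phi>) = fo_fv \<phi>"
| "fo_fv (FConj \<phi> \<psi>) = fo_fv \<phi> \<union> fo_fv \<psi>"
| "fo_fv (FAll x \<phi>) = fo_fv \<phi> - {x}"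

definition fo_sentence :: "fo_fm \<Rightarrow> bool" where
  "fo_sentence \<phi> \<longleftrightarrow> fo_fv \<phi> = {}"

fun rterm_val :: "('a, 'm) ring_scheme \<Rightarrow> (nat \<Rightarrow> 'a) \<Rightarrow> rterm \<Rightarrow> 'a" where
  "rterm_val R s (RVar x) = s x"
| "rterm_val R s (RAdd t u) = rterm_val R s t \<oplus>\<^bsub>R\<^esub> rterm_val R s u"
| "rterm_val R s (RMult t u) = rterm_val R s t \<otimes>\<^bsub>R\<^esub> rterm_val R s u"

fun fo_sat :: "('a, 'm) ring_scheme \<Rightarrow> (nat \<Rightarrow> 'a) \<Rightarrow> fo_fm \<Rightarrow> bool" where
  "fo_sat R s (FEq t u) \<longleftrightarrow> rterm_val R s t = rterm_val R s u"
| "fo_sat R s (FNeg \<phi>) \<longleftrightarrow> \<not> fo_sat R s \<phi>"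
| "fo_sat R s (FConj \<phi> \<psi>) \<longleftrightarrow> fo_sat R s \<phi> \<and> fo_sat R s \<psi>"
| "fo_sat R s (FAll x \<phi>) \<longleftrightarrow> (\<forall>a\<in>carrier R. fo_sat R (s(x := a)) \<phi>)"

definition fo_true :: "('a, 'm) ring_scheme \<Rightarrow> fo_fm \<Rightarrow> bool" where
  "fo_true R \<phi> \<longleftrightarrow> (\<forall>s. range s \<subseteq> carrier R \<longrightarrow> fo_sat R s \<phi>)"

definition elementarily_equivalent :: "('a, 'm) ring_scheme \<Rightarrow> ('b, 'n) ring_scheme \<Rightarrow> bool" where
  "elementarily_equivalent R S \<longleftrightarrow> (\<forall>\<phi>. fo_sentence \<phi> \<longrightarrow> (fo_true R \<phi> \<longleftrightarrow> fo_true S \<phi>))"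

end

theory Submission
  imports Defs
begin

text \<open>
  The endomorphism ring of \<open>A\<close> is interpretable in \<open>A\<close> by second order formulas that do not
  depend on \<open>A\<close>. An endomorphism is coded by its graph, a binary relation, and being the graph
  of an endomorphism is expressible: the relation is total, single valued and additive
  (\<open>so_sat_so_endo_iff\<close>). Sums and products of endomorphisms are defined pointwise and by
  composition, so ``the endomorphism \<open>t\<close> takes \<open>x\<close> to \<open>y\<close>'' is a formula built by recursion
  on the ring term \<open>t\<close> (\<open>so_sat_so_value\<close>).

  Reading each ring variable as a binary predicate variable and relativizing the ring
  quantifiers to graphs of endomorphisms therefore turns a ring sentence \<open>\<phi>\<close> into a sentence
  of the second order language that holds in \<open>A\<close> exactly when \<open>\<phi>\<close> holds in the endomorphism
  ring (\<open>so_true_so_of_fo\<close>). As the translation is the same for all groups, second order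
  equivalence of two groups passes to elementary equivalence of their endomorphism rings.
\<close>

section \<open>Graphs of endomorphisms\<close>

definition fun_graph :: "'a set \<Rightarrow> ('a \<Rightarrow> 'a) \<Rightarrow> 'a list set" where
  "fun_graph C f = {[x, f x] | x. x \<in> C}"

lemma pair_in_fun_graph_iff [simp]: "[x, y] \<in> fun_graph C f \<longleftrightarrow> x \<in> C \<and> y = f x"
  by (auto simp: fun_graph_def)

lemma tuples_2_eq: "tuples C 2 = {[x, y] | x y. x \<in> C \<and> y \<in> C}"
  by (auto simp: tuples_def numeral_2_eq_2 length_Suc_conv)

lemma fun_graph_subset_tuples:
  assumes "f \<in> C \<rightarrow> C"
  shows "fun_graph C f \<subseteq> tuples C 2"
  using assms by (auto simp: fun_graph_def tuples_2_eq)

lemma carrier_End_ringD: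
  assumes "f \<in> carrier (End_ring A)"
  shows "f \<in> carrier A \<rightarrow> carrier A"
    and "\<lbrakk>x \<in> carrier A; y \<in> carrier A\<rbrakk> \<Longrightarrow> f (x \<otimes>\<^bsub>A\<^esub> y) = f x \<otimes>\<^bsub>A\<^esub> f y"
  using assms by (auto simp: End_ring_def hom_def)

text \<open>
  The right-hand side mentions only elements of the group and membership in the relation, so it can
  be written down in the second order language.
\<close>

lemma fun_graph_endo_iff:
  assumes R: "R \<subseteq> tuples (carrier A) 2" and A: "comm_group A"
  shows "(\<exists>f\<in>carrier (End_ring A). R = fun_graph (carrier A) f) \<longleftrightarrow>
    (\<forall>x\<in>carrier A. \<exists>y\<in>carrier A. [x, y] \<in> R) \<and>
    (\<forall>x\<in>carrier A. \<forall>y\<in>carrier A. \<forall>z\<in>carrier A. [x, y] \<in> R \<longrightarrow> [x, z] \<in> R \<longrightarrow> y = z) \<and>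
    (\<forall>x\<in>carrier A. \<forall>y\<in>carrier A. \<forall>u\<in>carrier A. \<forall>v\<in>carrier A.
       [x, u] \<in> R \<longrightarrow> [y, v] \<in> R \<longrightarrow> [x \<otimes>\<^bsub>A\<^esub> y, u \<otimes>\<^bsub>A\<^esub> v] \<in> R)"
    (is "?L \<longleftrightarrow> ?total \<and> ?functional \<and> ?additive")
proof
  interpret comm_group A by fact
  assume ?L
  then obtain f where "f \<in> carrier (End_ring A)" "R = fun_graph (carrier A) f"
    by blast
  with carrier_End_ringD[of f A] show "?total \<and> ?functional \<and> ?additive"
    by (auto simp: Pi_iff)
next
  interpret comm_group A by fact
  assume *: "?total \<and> ?functional \<and> ?additive"
  define f where "f = (\<lambda>x\<in>carrier A. THE y. y \<in> carrier A \<and> [x, y] \<in> R)"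
  have f: "f x \<in> carrier A \<and> [x, f x] \<in> R" if x: "x \<in> carrier A" for x
  proof -
    from * x have "\<exists>!y. y \<in> carrier A \<and> [x, y] \<in> R"
      by blast
    from theI'[OF this] x show ?thesis
      by (simp add: f_def)
  qed
  have f_eq: "y = f x" if "x \<in> carrier A" "y \<in> carrier A" "[x, y] \<in> R" for x y
    using * f[OF that(1)] that by blast
  have "f (x \<otimes>\<^bsub>A\<^esub> y) = f x \<otimes>\<^bsub>A\<^esub> f y" if "x \<in> carrier A" "y \<in> carrier A" for x y
  proof -
    from * f[OF that(1)] f[OF that(2)] that
    have "[x \<otimes>\<^bsub>A\<^esub> y, f x \<otimes>\<^bsub>A\<^esub> f y] \<in> R"
      by blast
    with f_eq[of "x \<otimes>\<^bsub>A\<^esub> y" "f x \<otimes>\<^bsub>A\<^esub> f y"] f that show ?thesis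
      by simp
  qed
  moreover have "f \<in> extensional (carrier A)"
    by (simp add: f_def)
  ultimately have "f \<in> carrier (End_ring A)"
    using f by (simp add: End_ring_def hom_def)
  moreover have "R = fun_graph (carrier A) f"
  proof (intro subset_antisym subsetI)
    fix p assume "p \<in> R"
    with R obtain x y where "p = [x, y]" "x \<in> carrier A" "y \<in> carrier A"
      by (auto simp: tuples_2_eq)
    with \<open>p \<in> R\<close> f_eq show "p \<in> fun_graph (carrier A) f"
      by simp
  next
    fix p assume "p \<in> fun_graph (carrier A) f"
    with f show "p \<in> R"
      by (auto simp: fun_graph_def)
  qed
  ultimately show ?L
    by blast
qed

section \<open>Derived connectives of the second order language\<close>

definition SImp :: "so_fm \<Rightarrow> so_fm \<Rightarrow> so_fm" where
  "SImp \<phi> \<psi> = SNeg (SConj \<phi> (SNeg \<psi>))"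

definition SEx :: "nat \<Rightarrow> so_fm \<Rightarrow> so_fm" where
  "SEx x \<phi> = SNeg (SAll x (SNeg \<phi>))"

lemma SImp_simps [simp]:
  "so_sat A s P (SImp \<phi> \<psi>) \<longleftrightarrow> (so_sat A s P \<phi> \<longrightarrow> so_sat A s P \<psi>)"
  "so_wf (SImp \<phi> \<psi>) \<longleftrightarrow> so_wf \<phi> \<and> so_wf \<psi>"
  "so_fv (SImp \<phi> \<psi>) = so_fv \<phi> \<union> so_fv \<psi>"
  "so_fpv (SImp \<phi> \<psi>) = so_fpv \<phi> \<union> so_fpv \<psi>"
  by (auto simp: SImp_def)

lemma SEx_simps [simp]:
  "so_sat A s P (SEx x \<phi>) \<longleftrightarrow> (\<exists>a\<in>carrier A. so_sat A (s(x := a)) P \<phi>)"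
  "so_wf (SEx x \<phi>) \<longleftrightarrow> so_wf \<phi>"
  "so_fv (SEx x \<phi>) = so_fv \<phi> - {x}"
  "so_fpv (SEx x \<phi>) = so_fpv \<phi>"
  by (auto simp: SEx_def)

section \<open>The translation of ring formulas\<close>

definition so_endo :: "nat \<Rightarrow> so_fm" where
  "so_endo i =
    SConj (SAll 0 (SEx 1 (SPred i [0, 1])))
   (SConj (SAll 0 (SAll 1 (SAll 2
            (SImp (SPred i [0, 1]) (SImp (SPred i [0, 2]) (SEq 1 2))))))
          (SAll 0 (SAll 1 (SAll 2 (SAll 3
            (SImp (SPred i [0, 2]) (SImp (SPred i [1, 3])
              (SAll 4 (SAll 5 (SImp (SAdd 4 0 1) (SImp (SAdd 5 2 3) (SPred i [4, 5]))))))))))))"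

text \<open>
  \<open>so_value t x y\<close> says that \<open>t\<close>, read as an endomorphism, takes \<open>x\<close> to \<open>y\<close>. The intermediate
  values are bound to variables beyond \<open>x + y\<close>, which makes them distinct from \<open>x\<close> and \<open>y\<close>.
  For a sum, \<open>so_value t x v\<close> may bind \<open>w\<close> again; this is harmless because \<open>w\<close> is not free
  in it, so no supply of globally fresh variables has to be carried along.
\<close>

fun so_value :: "rterm \<Rightarrow> nat \<Rightarrow> nat \<Rightarrow> so_fm" where
  "so_value (RVar i) x y = SPred i [x, y]"
| "so_value (RAdd t u) x y =
    (let v = Suc (x + y); w = Suc v
     in SEx v (SEx w (SConj (SConj (so_value t x v) (so_value u x w)) (SAdd y v w))))"
| "so_value (RMult t u) x y =
    (let v = Suc (x + y) in SEx v (SConj (so_value u x v) (so_value t v y)))"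

fun so_of_fo :: "fo_fm \<Rightarrow> so_fm" where
  "so_of_fo (FEq t u) = SAll 0 (SEx 1 (SConj (so_value t 0 1) (so_value u 0 1)))"
| "so_of_fo (FNeg \<phi>) = SNeg (so_of_fo \<phi>)"
| "so_of_fo (FConj \<phi> \<psi>) = SConj (so_of_fo \<phi>) (so_of_fo \<psi>)"
| "so_of_fo (FAll i \<phi>) = SAllP 2 i (SImp (so_endo i) (so_of_fo \<phi>))"

lemma so_endo_syntax [simp]:
  "so_wf (so_endo i)" "so_fv (so_endo i) = {}" "so_fpv (so_endo i) = {(2, i)}"
  by (auto simp: so_endo_def)

lemma so_value_syntax:
  "so_wf (so_value t x y)"
  "so_fv (so_value t x y) \<subseteq> {x, y}"
  "so_fpv (so_value t x y) = Pair 2 ` rterm_vars t"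
proof -
  show "so_wf (so_value t x y)"
    by (induction t arbitrary: x y) (auto simp: Let_def)
  show "so_fv (so_value t x y) \<subseteq> {x, y}"
    by (induction t arbitrary: x y) (fastforce simp: Let_def)+
  show "so_fpv (so_value t x y) = Pair 2 ` rterm_vars t"
    by (induction t arbitrary: x y) (auto simp: Let_def)
qed

lemma so_of_fo_syntax:
  "so_wf (so_of_fo \<phi>)"
  "so_fv (so_of_fo \<phi>) = {}"
  "so_fpv (so_of_fo \<phi>) = Pair 2 ` fo_fv \<phi>"
proof -
  show "so_wf (so_of_fo \<phi>)"
    by (induction \<phi>) (auto simp: so_value_syntax)
  show "so_fv (so_of_fo \<phi>) = {}"
    using so_value_syntax(2) by (induction \<phi>) fastforce+
  show "so_fpv (so_of_fo \<phi>) = Pair 2 ` fo_fv \<phi>"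
    by (induction \<phi>) (auto simp: so_value_syntax)
qed

lemma so_sentence_so_of_fo: "fo_sentence \<phi> \<Longrightarrow> so_sentence (so_of_fo \<phi>)"
  by (simp add: so_sentence_def fo_sentence_def so_of_fo_syntax)

section \<open>Correctness of the translation\<close>

lemma so_sat_so_endo_iff:
  assumes "comm_group A" and "P (2, i) \<subseteq> tuples (carrier A) 2"
  shows "so_sat A s P (so_endo i) \<longleftrightarrow>
    (\<exists>f\<in>carrier (End_ring A). P (2, i) = fun_graph (carrier A) f)"
proof -
  interpret comm_group A by fact
  show ?thesis
    unfolding fun_graph_endo_iff[OF assms(2,1)]
    by (simp add: so_endo_def numeral_2_eq_2[symmetric])
qed

lemma rterm_val_End_ring_closed:
  assumes "comm_group A" and "\<And>i. f i \<in> carrier (End_ring A)"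
  shows "rterm_val (End_ring A) f t \<in> carrier (End_ring A)"
proof -
  interpret R: ring "End_ring A"
    by (rule ring_End_ring[OF assms(1)])
  show ?thesis
    using assms(2) by (induction t) auto
qed

lemma so_sat_so_value:
  assumes A: "comm_group A" and f: "\<And>i. f i \<in> carrier (End_ring A)"
    and P: "\<And>i. i \<in> rterm_vars t \<Longrightarrow> P (2, i) = fun_graph (carrier A) (f i)"
    and s: "s x \<in> carrier A" "s y \<in> carrier A"
  shows "so_sat A s P (so_value t x y) \<longleftrightarrow> s y = rterm_val (End_ring A) f t (s x)"
  using P s
proof (induction t arbitrary: s x y)
  case (RVar i)
  then show ?case
    by (simp add: numeral_2_eq_2[symmetric])
next
  case (RAdd t u)
  have "rterm_val (End_ring A) f r (s x) \<in> carrier A" for r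
    using carrier_End_ringD(1)[OF rterm_val_End_ring_closed[of A f r]] A f RAdd.prems by blast
  with RAdd show ?case
    by (auto simp: Let_def End_ring_def)
next
  case (RMult t u)
  have "rterm_val (End_ring A) f r (s x) \<in> carrier A" for r
    using carrier_End_ringD(1)[OF rterm_val_End_ring_closed[of A f r]] A f RMult.prems by blast
  with RMult show ?case
    by (auto simp: Let_def End_ring_def compose_def)
qed

lemma End_ring_eq_iff:
  assumes "f \<in> carrier (End_ring A)" "g \<in> carrier (End_ring A)"
  shows "f = g \<longleftrightarrow> (\<forall>x\<in>carrier A. f x = g x)"
  using assms by (auto simp: End_ring_def intro: extensionalityI)

text \<open>
  Requiring \<open>P\<close> to code \<open>f\<close> only at the free variables makes the hypothesis vacuous for
  sentences, where \<open>P\<close> and \<open>f\<close> then are independent of each other.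
\<close>

lemma so_sat_so_of_fo:
  assumes A: "comm_group A" and f: "\<And>i. f i \<in> carrier (End_ring A)"
    and P: "\<And>i. i \<in> fo_fv \<phi> \<Longrightarrow> P (2, i) = fun_graph (carrier A) (f i)"
  shows "so_sat A s P (so_of_fo \<phi>) \<longleftrightarrow> fo_sat (End_ring A) f \<phi>"
  using f P
proof (induction \<phi> arbitrary: s P f)
  case (FEq t u)
  let ?val = "rterm_val (End_ring A) f"
  have closed: "?val r \<in> carrier (End_ring A)" for r
    by (rule rterm_val_End_ring_closed[OF A FEq.prems(1)])
  have val: "so_sat A s P (so_value r 0 1) \<longleftrightarrow> s 1 = ?val r (s 0)"
    if "r \<in> {t, u}" "s 0 \<in> carrier A" "s 1 \<in> carrier A" for r s
    using that by (intro so_sat_so_value[OF A FEq.prems(1)] FEq.prems(2)) auto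
  have "so_sat A s P (so_of_fo (FEq t u)) \<longleftrightarrow>
      (\<forall>x\<in>carrier A. \<exists>y\<in>carrier A. y = ?val t x \<and> y = ?val u x)"
    using val by simp
  also have "\<dots> \<longleftrightarrow> (\<forall>x\<in>carrier A. ?val t x = ?val u x)"
    using carrier_End_ringD(1)[OF closed] by fastforce
  also have "\<dots> \<longleftrightarrow> ?val t = ?val u"
    by (rule End_ring_eq_iff[symmetric]) (rule closed)+
  finally show ?case
    by simp
next
  case (FNeg \<phi>)
  then show ?case by simp
next
  case (FConj \<phi> \<psi>)
  have "so_sat A s P (so_of_fo \<phi>) \<longleftrightarrow> fo_sat (End_ring A) f \<phi>"
    using FConj.prems by (intro FConj.IH(1)) auto
  moreover have "so_sat A s P (so_of_fo \<psi>) \<longleftrightarrow> fo_sat (End_ring A) f \<psi>"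
    using FConj.prems by (intro FConj.IH(2)) auto
  ultimately show ?case
    by simp
next
  case (FAll i \<phi>)
  have IH: "so_sat A s (P((2, i) := fun_graph (carrier A) g)) (so_of_fo \<phi>) \<longleftrightarrow>
      fo_sat (End_ring A) (f(i := g)) \<phi>" if "g \<in> carrier (End_ring A)" for g
    using that FAll.prems by (intro FAll.IH) auto
  have "so_sat A s P (so_of_fo (FAll i \<phi>)) \<longleftrightarrow>
      (\<forall>R. R \<subseteq> tuples (carrier A) 2 \<longrightarrow>
        (\<exists>g\<in>carrier (End_ring A). R = fun_graph (carrier A) g) \<longrightarrow>
        so_sat A s (P((2, i) := R)) (so_of_fo \<phi>))"
    using A by (simp add: so_sat_so_endo_iff)
  also have "\<dots> \<longleftrightarrow> (\<forall>g\<in>carrier (End_ring A).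
      so_sat A s (P((2, i) := fun_graph (carrier A) g)) (so_of_fo \<phi>))"
    using fun_graph_subset_tuples[OF carrier_End_ringD(1)] by blast
  also have "\<dots> \<longleftrightarrow> fo_sat (End_ring A) f (FAll i \<phi>)"
    using IH by simp
  finally show ?case .
qed

lemma so_true_so_of_fo:
  assumes A: "comm_group A" and \<phi>: "fo_sentence \<phi>"
  shows "so_true A (so_of_fo \<phi>) \<longleftrightarrow> fo_true (End_ring A) \<phi>"
proof -
  interpret comm_group A by fact
  interpret R: ring "End_ring A"
    by (rule ring_End_ring[OF A])
  have *: "so_sat A s P (so_of_fo \<phi>) \<longleftrightarrow> fo_sat (End_ring A) f \<phi>"
    if "range f \<subseteq> carrier (End_ring A)" for s P f
    using that \<phi> by (intro so_sat_so_of_fo[OF A]) (auto simp: fo_sentence_def)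
  \<comment> \<open>Truth quantifies over all assignments, so each direction needs some assignment of the
    other kind to exist; constant ones serve.\<close>
  have "range (\<lambda>i::nat. \<zero>\<^bsub>End_ring A\<^esub>) \<subseteq> carrier (End_ring A)"
    by auto
  moreover have "range (\<lambda>i::nat. \<one>\<^bsub>A\<^esub>) \<subseteq> carrier A"
    by auto
  moreover have "\<forall>n k. (\<lambda>_. {}) (n :: nat, k :: nat) \<subseteq> tuples (carrier A) n"
    by simp
  ultimately show ?thesis
    unfolding so_true_def fo_true_def using * by meson
qed

theorem theorem2:
  fixes A1 :: "('a, 'm) monoid_scheme" and A2 :: "('b, 'n) monoid_scheme"
  assumes "comm_group A1" and "comm_group A2"
    and "so_equivalent A1 A2"
  shows "elementarily_equivalent (End_ring A1) (End_ring A2)"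
  unfolding elementarily_equivalent_def
  using assms so_true_so_of_fo so_sentence_so_of_fo
  by (metis so_equivalent_def)

end
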